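(* Let $\Gamma$ be the path on $K$ vertices. Given $\lambda>1$, $K=\omega(\sqrt n)$ and $K=o(n)$, for a realization $G$ of the graph under $\mathbb{P}_1$, every estimator $\hat{\mathcal K}$ of the planted node set achieves negligible overlap: $\mathrm{ov}(\hat{\mathcal K})=o(K)$.
   Context: Model: $n$ nodes; $\lambda>0$ fixed. $\mathbb{P}_1$: $G=G_0\cup G'$ with $G_0\sim\mathcal G(n,\lambda/n)$ and $G'$ the image of the path $1-2-\cdots-K$ under an injection $\sigma:[K]\to[n]$ chosen uniformly at random independently of $G_0$; $\mathcal K=\sigma([K])$. An estimator is a set $\hat{\mathcal K}$ of $K$ nodes computed from $G$; $\mathrm{ov}(\hat{\mathcal K})=\sum_{i\in[n]}\mathbb{P}_1(i\in\hat{\mathcal K}\cap\mathcal K)$. Asymptotics as $n\to\infty$. *)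

theory Defs
  imports "HOL-Probability.Probability" "HOL-Library.Landau_Symbols"
begin

text \<open>Graphs on the node set [n] = {1..n} are represented by their edge sets:
  an edge is a 2-element subset of {1..n}.\<close>

definition node_pairs :: "nat \<Rightarrow> nat set set" where
  "node_pairs n = {{i, j} | i j. i \<in> {1..n} \<and> j \<in> {1..n} \<and> i \<noteq> j}"

definition erdos_renyi :: "nat \<Rightarrow> real \<Rightarrow> nat set set pmf" where
  "erdos_renyi n p =
     map_pmf (\<lambda>f. {e \<in> node_pairs n. f e})
       (Pi_pmf (node_pairs n) False (\<lambda>_. bernoulli_pmf p))"

definition injections :: "nat \<Rightarrow> nat \<Rightarrow> (nat \<Rightarrow> nat) set" where
  "injections K n = {\<sigma> \<in> {1..K} \<rightarrow>\<^sub>E {1..n}. inj_on \<sigma> {1..K}}"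

definition planted_path :: "nat \<Rightarrow> (nat \<Rightarrow> nat) \<Rightarrow> nat set set" where
  "planted_path K \<sigma> = {{\<sigma> i, \<sigma> (Suc i)} | i. 1 \<le> i \<and> i < K}"

definition P1 :: "nat \<Rightarrow> real \<Rightarrow> nat \<Rightarrow> (nat set set \<times> nat set) pmf" where
  "P1 n lam K =
     do { G0 \<leftarrow> erdos_renyi n (lam / real n);
          \<sigma> \<leftarrow> pmf_of_set (injections K n);
          return_pmf (G0 \<union> planted_path K \<sigma>, \<sigma> ` {1..K}) }"

definition overlap :: "nat \<Rightarrow> real \<Rightarrow> nat \<Rightarrow> (nat set set \<Rightarrow> nat set) \<Rightarrow> real" where
  "overlap n lam K est =
     (\<Sum>i\<in>{1..n}. measure_pmf.prob (P1 n lam K) {(G, S). i \<in> est G \<and> i \<in> S})"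

end

theory Submission
  imports Defs
begin

text \<open>
  Given the observed graph, the planted path is uniformly distributed over all paths on K
  vertices in that graph. Hence, by Cauchy-Schwarz, no estimator has a large overlap unless two
  such paths typically share a positive fraction of their vertices. In expectation under the
  Erdos-Renyi graph, the pairs of paths sharing more than a fraction \<open>\<epsilon>\<close> of their vertices
  are a negligible part, \<open>\<lambda>\<close> to the power \<open>- c \<epsilon> K\<close> up to a factor \<open>exp (o(K))\<close>, of the
  squared expected number of paths: following the fixed path along an edge costs a factor
  \<open>1 / \<lambda> < 1\<close>, and jumping onto it has probability \<open>K / n = o(1)\<close>.
\<close>

section \<open>The random graph and the planted path\<close>

lemma finite_node_pairs: "finite (node_pairs n)"
proof (rule finite_subset)
  show "node_pairs n \<subseteq> Pow {1..n}"
    by (auto simp: node_pairs_def)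
qed simp

lemma set_pmf_erdos_renyi_subset: "set_pmf (erdos_renyi n p) \<subseteq> Pow (node_pairs n)"
  by (auto simp: erdos_renyi_def)

text \<open>The state of \<open>e\<close> is independent of all other pairs. It is present with
  probability \<open>p\<close>, and then \<open>insert e G\<close> is \<open>G\<close> itself; when
  it is absent the right-hand integrand vanishes. Both sides are thus \<open>p\<close> times the
  mean of \<open>g\<close> with \<open>e\<close> switched on.\<close>

lemma expectation_erdos_renyi_insert:
  fixes g :: "nat set set \<Rightarrow> real"
  assumes e: "e \<in> node_pairs n" and p: "0 \<le> p" "p \<le> 1"
  shows "p * measure_pmf.expectation (erdos_renyi n p) (\<lambda>G. g (insert e G)) =
         measure_pmf.expectation (erdos_renyi n p) (\<lambda>G. of_bool (e \<in> G) * g G)"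
proof -
  define A where "A = node_pairs n - {e}"
  define R where "R = Pi_pmf A False (\<lambda>_. bernoulli_pmf p)"
  have np: "node_pairs n = insert e A" and eA: "e \<notin> A" and finA: "finite A"
    using e finite_node_pairs by (auto simp: A_def)
  have finR: "finite (set_pmf R)"
    unfolding R_def using finA by (subst set_Pi_pmf) (auto intro: finite_PiE_dflt)
  have er: "erdos_renyi n p =
      bernoulli_pmf p \<bind> (\<lambda>y. map_pmf (\<lambda>f. {x \<in> insert e A. (f(e := y)) x}) R)"
    unfolding erdos_renyi_def np R_def Pi_pmf_insert'[OF finA eA]
    by (simp add: map_bind_pmf map_pmf_def bind_assoc_pmf bind_return_pmf)
  have split: "measure_pmf.expectation (erdos_renyi n p) h =
      p * measure_pmf.expectation R (\<lambda>f. h {x \<in> insert e A. (f(e := True)) x}) +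
      (1 - p) * measure_pmf.expectation R (\<lambda>f. h {x \<in> insert e A. (f(e := False)) x})"
    for h :: "nat set set \<Rightarrow> real"
    unfolding er
    by (subst pmf_expectation_bind[where A = UNIV]) (use finR p in \<open>auto simp: UNIV_bool\<close>)
  have T: "insert e {x \<in> insert e A. (f(e := y)) x} = {x \<in> insert e A. (f(e := True)) x}" for f y
    by auto
  show ?thesis
    unfolding split T by (simp add: algebra_simps)
qed

text \<open>A change of measure: planting \<open>P\<close> amounts to conditioning on
  \<open>P\<close> being present, an event of probability \<open>p ^ card P\<close>. Expectations
  under the planted law thereby become sums over the paths present in a pure Erdos-Renyi
  graph.\<close>

lemma expectation_erdos_renyi_union:
  fixes g :: "nat set set \<Rightarrow> real"
  assumes "finite P" "P \<subseteq> node_pairs n" and p: "0 \<le> p" "p \<le> 1"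
  shows "p ^ card P * measure_pmf.expectation (erdos_renyi n p) (\<lambda>G. g (G \<union> P)) =
         measure_pmf.expectation (erdos_renyi n p) (\<lambda>G. of_bool (P \<subseteq> G) * g G)"
  using assms(1,2)
proof (induction P arbitrary: g rule: finite_induct)
  case (insert e P)
  have "p ^ card (insert e P) * measure_pmf.expectation (erdos_renyi n p) (\<lambda>G. g (G \<union> insert e P)) =
      p ^ card P * (p * measure_pmf.expectation (erdos_renyi n p) (\<lambda>G. g (insert e G \<union> P)))"
    using insert.hyps by simp
  also have "\<dots> = p ^ card P * measure_pmf.expectation (erdos_renyi n p) (\<lambda>G. of_bool (e \<in> G) * g (G \<union> P))"
    using insert.prems p by (subst expectation_erdos_renyi_insert[of e n p "\<lambda>G. g (G \<union> P)"]) auto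
  \<comment> \<open>As \<open>e\<close> lies outside \<open>P\<close>, its presence in
    \<open>G\<close> can be read off \<open>G \<union> P\<close>. The integrand is now a function of
    \<open>G \<union> P\<close>, as the induction hypothesis requires.\<close>
  also have "\<dots> = p ^ card P * measure_pmf.expectation (erdos_renyi n p)
      (\<lambda>G. of_bool (e \<in> G \<union> P) * g (G \<union> P))"
    using insert.hyps by simp
  also have "\<dots> = measure_pmf.expectation (erdos_renyi n p)
      (\<lambda>G. of_bool (P \<subseteq> G) * (of_bool (e \<in> G) * g G))"
    using insert.prems by (subst insert.IH[of "\<lambda>G. of_bool (e \<in> G) * g G"]) auto
  also have "\<dots> = measure_pmf.expectation (erdos_renyi n p) (\<lambda>G. of_bool (insert e P \<subseteq> G) * g G)"
    by (intro Bochner_Integration.integral_cong) auto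
  finally show ?case .
qed simp

section \<open>Injections built one vertex at a time\<close>

lemma finite_injections: "finite (injections K n)"
  by (rule finite_subset[of _ "{1..K} \<rightarrow>\<^sub>E {1..n}"]) (auto simp: injections_def finite_PiE)

text \<open>Exposing the last vertex gives the recursion by which sums over paths are estimated step
  by step: a prefix may be extended by any value it has not yet used.\<close>

lemma sum_injections_Suc:
  fixes F :: "(nat \<Rightarrow> nat) \<Rightarrow> 'a :: comm_monoid_add"
  shows "(\<Sum>\<tau>\<in>injections (Suc j) n. F \<tau>) =
         (\<Sum>\<sigma>\<in>injections j n. \<Sum>v\<in>{1..n} - \<sigma> ` {1..j}. F (\<sigma>(Suc j := v)))"
proof -
  have "(\<Sum>\<sigma>\<in>injections j n. \<Sum>v\<in>{1..n} - \<sigma> ` {1..j}. F (\<sigma>(Suc j := v))) =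
     (\<Sum>(\<sigma>, v)\<in>(SIGMA \<sigma>:injections j n. {1..n} - \<sigma> ` {1..j}). F (\<sigma>(Suc j := v)))"
    by (intro sum.Sigma) (auto simp: finite_injections)
  also have "\<dots> = (\<Sum>\<tau>\<in>injections (Suc j) n. F \<tau>)"
  \<comment> \<open>Injections are extensional, so removing the last vertex must also reset its
    value to \<open>undefined\<close>, which \<open>restrict\<close> does.\<close>
  proof (rule sum.reindex_bij_witness[where i = "\<lambda>\<tau>. (restrict \<tau> {1..j}, \<tau> (Suc j))"
        and j = "\<lambda>(\<sigma>, v). \<sigma>(Suc j := v)"], goal_cases)
    case (1 x)
    then show ?case
      by (auto simp: injections_def PiE_def extensional_def restrict_def fun_eq_iff)
  next
    case (2 x)
    obtain \<sigma> v where x: "x = (\<sigma>, v)" "\<sigma> \<in> injections j n" "v \<in> {1..n}" "v \<notin> \<sigma> ` {1..j}"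
      using 2 by auto
    have "\<sigma>(Suc j := v) \<in> {1..Suc j} \<rightarrow>\<^sub>E {1..n}"
      using x by (auto simp: injections_def PiE_def extensional_def Pi_def)
    moreover have "inj_on (\<sigma>(Suc j := v)) (insert (Suc j) {1..j})"
      using x by (auto simp: injections_def inj_on_fun_updI)
    ultimately show ?case
      using x by (simp add: injections_def atLeastAtMostSuc_conv)
  next
    case (3 \<tau>)
    then show ?case
      by (auto simp: injections_def PiE_def extensional_def restrict_def fun_eq_iff le_Suc_eq)
  next
    case (4 \<tau>)
    have \<tau>: "\<tau> \<in> {1..Suc j} \<rightarrow>\<^sub>E {1..n}" "inj_on \<tau> (insert (Suc j) {1..j})"
      using 4 by (auto simp: injections_def atLeastAtMostSuc_conv)
    then have "inj_on \<tau> {1..j}" "\<tau> (Suc j) \<notin> \<tau> ` {1..j}"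
      by (auto simp: inj_on_insert)
    then show ?case
      using \<tau>(1) by (auto simp: injections_def inj_on_restrict_eq)
  qed auto
  finally show ?thesis ..
qed

lemma card_injections_image: "\<sigma> \<in> injections j n \<Longrightarrow> card (\<sigma> ` {1..j}) = j"
  by (simp add: injections_def card_image)

lemma card_injections_Suc:
  assumes "j \<le> n"
  shows "card (injections (Suc j) n) = (n - j) * card (injections j n)"
proof -
  have "card ({1..n} - \<sigma> ` {1..j}) = n - j" if "\<sigma> \<in> injections j n" for \<sigma>
    using that card_injections_image[OF that]
    by (subst card_Diff_subset) (auto simp: injections_def)
  then show ?thesis
    using sum_injections_Suc[of "\<lambda>_. 1 :: nat" j n] by simp
qed

section \<open>Edges and degrees of a planted path\<close>

lemma planted_path_image: "planted_path K \<sigma> = (\<lambda>i. {\<sigma> i, \<sigma> (Suc i)}) ` {1..<K}"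
  by (auto simp: planted_path_def)

text \<open>Two edges that agree crosswise would give both \<open>i = Suc k\<close> and
  \<open>k = Suc i\<close>, so they can only agree end by end.\<close>

lemma inj_on_planted_path:
  assumes "\<sigma> \<in> injections K n"
  shows "inj_on (\<lambda>i. {\<sigma> i, \<sigma> (Suc i)}) {1..<K}"
proof (rule inj_onI)
  fix i k assume ik: "i \<in> {1..<K}" "k \<in> {1..<K}" and "{\<sigma> i, \<sigma> (Suc i)} = {\<sigma> k, \<sigma> (Suc k)}"
  moreover have "inj_on \<sigma> {1..K}"
    using assms by (simp add: injections_def)
  then have "\<sigma> x = \<sigma> y \<longleftrightarrow> x = y" if "x \<in> {1..K}" "y \<in> {1..K}" for x y
    using that by (auto simp: inj_on_eq_iff)
  ultimately show "i = k"
    by (auto simp: doubleton_eq_iff)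
qed

lemma card_planted_path: "\<sigma> \<in> injections K n \<Longrightarrow> card (planted_path K \<sigma>) = K - 1"
  unfolding planted_path_image by (subst card_image[OF inj_on_planted_path]) auto

lemma planted_path_subset:
  assumes "\<sigma> \<in> injections K n"
  shows "planted_path K \<sigma> \<subseteq> node_pairs n"
proof
  fix e assume "e \<in> planted_path K \<sigma>"
  then obtain i where i: "e = {\<sigma> i, \<sigma> (Suc i)}" "i \<in> {1..K}" "Suc i \<in> {1..K}"
    by (auto simp: planted_path_def)
  have "\<sigma> i \<in> {1..n}" "\<sigma> (Suc i) \<in> {1..n}" "\<sigma> i \<noteq> \<sigma> (Suc i)"
    using assms i(2,3) inj_on_eq_iff[of \<sigma> "{1..K}" i "Suc i"]
    by (auto simp: injections_def PiE_def Pi_def)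
  then show "e \<in> node_pairs n"
    unfolding node_pairs_def i(1) by blast
qed

text \<open>The two facts about the fixed path on which the transfer estimate rests: its edges stay
  inside its vertex set, and its degrees are at most 2.\<close>

lemma planted_path_neighbours:
  assumes "\<sigma> \<in> injections K n"
  shows "{v. {u, v} \<in> planted_path K \<sigma>} \<subseteq> \<sigma> ` {1..K}"
    and "card {v. {u, v} \<in> planted_path K \<sigma>} \<le> 2"
proof -
  show sub: "{v. {u, v} \<in> planted_path K \<sigma>} \<subseteq> \<sigma> ` {1..K}"
    by (auto simp: planted_path_def doubleton_eq_iff)
  show "card {v. {u, v} \<in> planted_path K \<sigma>} \<le> 2"
  proof (cases "\<exists>i\<in>{1..K}. u = \<sigma> i")
    case True
    then obtain i where i: "i \<in> {1..K}" "u = \<sigma> i" by auto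
    \<comment> \<open>For \<open>i = 1\<close> the right-hand set also contains the meaningless
      value \<open>\<sigma> 0\<close>; this is harmless for an upper bound on the degree.\<close>
    have "{v. {u, v} \<in> planted_path K \<sigma>} \<subseteq> {\<sigma> (i - 1), \<sigma> (Suc i)}"
    proof
      fix v assume "v \<in> {v. {u, v} \<in> planted_path K \<sigma>}"
      then obtain k where k: "k \<in> {1..K}" "Suc k \<in> {1..K}"
        and "\<sigma> i = \<sigma> k \<and> v = \<sigma> (Suc k) \<or> \<sigma> i = \<sigma> (Suc k) \<and> v = \<sigma> k"
        by (auto simp: planted_path_def doubleton_eq_iff i)
      moreover have "\<sigma> i = \<sigma> k \<longleftrightarrow> i = k" "\<sigma> i = \<sigma> (Suc k) \<longleftrightarrow> i = Suc k"
        using assms i(1) k by (auto simp: injections_def inj_on_eq_iff)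
      ultimately show "v \<in> {\<sigma> (i - 1), \<sigma> (Suc i)}"
        by auto
    qed
    then have "card {v. {u, v} \<in> planted_path K \<sigma>} \<le> card {\<sigma> (i - 1), \<sigma> (Suc i)}"
      by (intro card_mono) auto
    also have "\<dots> \<le> 2" by (simp add: card_insert_if)
    finally show ?thesis .
  next
    case False
    then have "{v. {u, v} \<in> planted_path K \<sigma>} = {}"
      by (auto simp: planted_path_def doubleton_eq_iff)
    then show ?thesis by simp
  qed
qed

section \<open>Pairs of paths with large overlap\<close>

text \<open>With \<open>c = 1 / p\<close> the edge product is the ratio between the probability that
  both paths are present and the product of their probabilities. The vertex product is an
  exponential tilt which, for \<theta> > 1, penalises shared vertices. The weight is defined for
  prefixes so that it can be followed along the path.\<close>

definition path_weight ::
    "real \<Rightarrow> real \<Rightarrow> nat set \<Rightarrow> nat set set \<Rightarrow> nat \<Rightarrow> (nat \<Rightarrow> nat) \<Rightarrow> real" where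
  "path_weight \<theta> c S E j \<sigma> =
     (\<Prod>i\<in>{1..j}. if \<sigma> i \<in> S then \<theta> else 1) *
     (\<Prod>i\<in>{1..<j}. if {\<sigma> i, \<sigma> (Suc i)} \<in> E then c else 1)"

text \<open>
  A supersolution for the transfer operator of the weighted walk: its value is 1 outside the
  fixed path, \<open>b\<close> after a step along the path (one path neighbour is left) and \<open>a\<close> after a jump
  onto it (up to two path neighbours are left).
\<close>

definition path_potential ::
    "real \<Rightarrow> real \<Rightarrow> nat set \<Rightarrow> nat set set \<Rightarrow> nat \<Rightarrow> (nat \<Rightarrow> nat) \<Rightarrow> real" where
  "path_potential a b S E j \<sigma> =
     (if j = 0 \<or> \<sigma> j \<notin> S then 1
      else if 1 < j \<and> {\<sigma> (j - 1), \<sigma> j} \<in> E then b else a)"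

lemma path_weight_nonneg: "\<theta> \<ge> 0 \<Longrightarrow> c \<ge> 0 \<Longrightarrow> path_weight \<theta> c S E j \<sigma> \<ge> 0"
  unfolding path_weight_def by (intro mult_nonneg_nonneg prod_nonneg) auto

lemma path_weight_Suc:
  "path_weight \<theta> c S E (Suc j) (\<sigma>(Suc j := v)) =
     path_weight \<theta> c S E j \<sigma> * (if v \<in> S then \<theta> else 1) *
     (if 0 < j \<and> {\<sigma> j, v} \<in> E then c else 1)"
proof -
  have "(\<Prod>i\<in>{1..Suc j}. if (\<sigma>(Suc j := v)) i \<in> S then \<theta> else 1) =
      (\<Prod>i\<in>{1..j}. if \<sigma> i \<in> S then \<theta> else 1) * (if v \<in> S then \<theta> else 1)"
    by (simp add: atLeastAtMostSuc_conv)
  moreover have "(\<Prod>i\<in>{1..<Suc j}. if {(\<sigma>(Suc j := v)) i, (\<sigma>(Suc j := v)) (Suc i)} \<in> E then c else 1) =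
      (\<Prod>i\<in>{1..<j}. if {\<sigma> i, \<sigma> (Suc i)} \<in> E then c else 1) *
      (if 0 < j \<and> {\<sigma> j, v} \<in> E then c else 1)"
    by (cases j) (simp_all add: atLeastLessThanSuc)
  ultimately show ?thesis
    by (simp add: path_weight_def)
qed

lemma path_potential_Suc:
  "path_potential a b S E (Suc j) (\<sigma>(Suc j := v)) =
     (if v \<notin> S then 1 else if 0 < j \<and> {\<sigma> j, v} \<in> E then b else a)"
  by (simp add: path_potential_def)

lemma sum_step_weight_le:
  fixes \<theta> c a b :: real
  assumes "finite M" "finite S" "D \<subseteq> S" "\<theta> \<ge> 0" "c \<ge> 0" "a \<ge> 0" "b \<ge> 0"
  shows "(\<Sum>v\<in>M. (if v \<in> S then \<theta> else 1) * (if v \<in> D then c else 1) *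
            (if v \<notin> S then 1 else if v \<in> D then b else a))
       \<le> card M + \<theta> * a * card S + \<theta> * c * b * card (M \<inter> D)"
proof -
  have "(\<Sum>v\<in>M. (if v \<in> S then \<theta> else 1) * (if v \<in> D then c else 1) *
            (if v \<notin> S then 1 else if v \<in> D then b else a))
      \<le> (\<Sum>v\<in>M. 1 + \<theta> * a * of_bool (v \<in> S) + \<theta> * c * b * of_bool (v \<in> D))"
    using assms by (intro sum_mono) auto
  also have "\<dots> = card M + \<theta> * a * card (M \<inter> S) + \<theta> * c * b * card (M \<inter> D)"
    using assms(1) by (simp add: sum.distrib sum_distrib_left[symmetric] of_bool_def sum.If_cases)
  also have "\<dots> \<le> card M + \<theta> * a * card S + \<theta> * c * b * card (M \<inter> D)"
    using assms by (intro add_mono mult_left_mono) (auto intro!: card_mono)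
  finally show ?thesis .
qed

text \<open>Each step multiplies the sum by at most \<open>(n - j) * (1 + \<delta>)\<close>, and
  \<open>n - j\<close> is the growth of the number of injections. Steps along fixed edges are
  absorbed by the potential, while jumps onto \<open>S\<close> make up \<delta>. The constants solve
  \<open>b = 1 + r * b\<close> (one neighbour left) and \<open>a = 1 + 2 * r * b\<close> (two
  left).\<close>

lemma sum_path_weight_potential_le:
  fixes \<theta> c r a b \<delta> :: real
  assumes S: "finite S" "card S \<le> K" and "K < n"
    and E: "\<And>u. {v. {u, v} \<in> E} \<subseteq> S" "\<And>u. card {v. {u, v} \<in> E} \<le> 2"
    and \<theta>: "\<theta> \<ge> 0" and c: "c \<ge> 0" and r: "0 \<le> r" "r < 1" "\<theta> * c \<le> r * (n - K)"
    and b: "b = 1 / (1 - r)" and a: "a = 1 + 2 * r * b" and \<delta>: "\<delta> = \<theta> * a * K / (n - K)"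
    and "j \<le> K"
  shows "(\<Sum>\<sigma>\<in>injections j n. path_weight \<theta> c S E j \<sigma> * path_potential a b S E j \<sigma>)
       \<le> (1 + \<delta>) ^ j * card (injections j n)"
  using \<open>j \<le> K\<close>
proof (induction j)
  case 0
  show ?case
    by (simp add: path_weight_def path_potential_def)
next
  case (Suc j)
  have b1: "b \<ge> 1" and rb: "r * b = b - 1"
    using r by (auto simp: b field_simps)
  have a1: "a \<ge> 1"
    using b1 r by (simp add: a)
  have \<delta>0: "\<delta> \<ge> 0"
    using \<theta> a1 \<open>K < n\<close> by (simp add: \<delta>)
  have step: "(\<Sum>v\<in>{1..n} - \<sigma> ` {1..j}. path_weight \<theta> c S E (Suc j) (\<sigma>(Suc j := v)) *
        path_potential a b S E (Suc j) (\<sigma>(Suc j := v)))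
      \<le> path_weight \<theta> c S E j \<sigma> * (real (n - j) * (1 + \<delta>) * path_potential a b S E j \<sigma>)"
    if \<sigma>: "\<sigma> \<in> injections j n" for \<sigma>
  proof -
    define M where "M = {1..n} - \<sigma> ` {1..j}"
    define D where "D = {v. 0 < j \<and> {\<sigma> j, v} \<in> E}"
    define h where "h = path_potential a b S E j \<sigma>"
    have m: "card M = n - j" and finM: "finite M"
      using card_injections_image[OF \<sigma>] \<sigma> unfolding M_def
      by (subst card_Diff_subset) (auto simp: injections_def)
    have mK: "real (n - K) \<le> real (n - j)"
      using Suc.prems by simp
    have m\<delta>: "\<theta> * a * card S \<le> real (n - j) * \<delta>"
    proof -
      have "\<theta> * a * card S \<le> \<theta> * a * K"
        using S \<theta> a1 by (intro mult_left_mono) auto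
      also have "\<dots> = real (n - K) * \<delta>"
        using \<open>K < n\<close> by (simp add: \<delta>)
      also have "\<dots> \<le> real (n - j) * \<delta>"
        using mK \<delta>0 by (intro mult_right_mono)
      finally show ?thesis .
    qed
    have DS: "D \<subseteq> S" and cardD: "card D \<le> 2"
      using E[of "\<sigma> j"] by (cases "j = 0"; auto simp: D_def)+
    have finD: "finite D"
      using DS S finite_subset by blast
    have MD: "card (M \<inter> D) \<le> 2"
      using cardD card_mono[OF finD, of "M \<inter> D"] by simp
    have h1: "h \<ge> 1"
      using a1 b1 by (simp add: h_def path_potential_def)
    \<comment> \<open>The surplus \<open>h - 1\<close> pays \<open>r * b\<close> for every neighbour
      still available: none off \<open>S\<close>, at most one after a step along an edge, at most
      two after a jump.\<close>
    have key: "r * b * card (M \<inter> D) \<le> h - 1"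
    proof (cases "j = 0 \<or> \<sigma> j \<notin> S")
      case True
      have "D = {}"
        using True E(1) by (auto simp: D_def) (metis insert_commute mem_Collect_eq subsetD)
      then show ?thesis using h1 by simp
    next
      case False
      show ?thesis
      proof (cases "1 < j \<and> {\<sigma> (j - 1), \<sigma> j} \<in> E")
        case True
        \<comment> \<open>The vertex just left is a neighbour on the fixed path that is already used
          up, so at most one remains.\<close>
        have "\<sigma> (j - 1) \<in> D - M"
          using True by (auto simp: D_def M_def insert_commute)
        then have "card (M \<inter> D) < card D"
          using finD by (intro psubset_card_mono) auto
        then have "real (card (M \<inter> D)) \<le> 1"
          using cardD by simp
        then have "r * b * card (M \<inter> D) \<le> r * b * 1"
          using r b1 by (intro mult_left_mono) auto
        then show ?thesis
          using True False rb by (simp add: h_def path_potential_def)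
      next
        case nb: False
        have "r * b * card (M \<inter> D) \<le> r * b * 2"
          using MD r b1 by (intro mult_left_mono) auto
        moreover have "h = a"
          using nb False unfolding h_def path_potential_def by (simp only: if_False)
        ultimately show ?thesis
          by (simp add: a)
      qed
    qed
    have "\<theta> * c * b * card (M \<inter> D) \<le> (r * real (n - j)) * b * card (M \<inter> D)"
    proof (intro mult_right_mono)
      show "\<theta> * c \<le> r * real (n - j)"
        using r(3) mult_left_mono[OF mK r(1)] \<open>K < n\<close> by (simp add: of_nat_diff)
    qed (use b1 in auto)
    also have "\<dots> = real (n - j) * (r * b * card (M \<inter> D))"
      by simp
    also have "\<dots> \<le> real (n - j) * (h - 1)"
      using key by (intro mult_left_mono) auto
    finally have edge: "\<theta> * c * b * card (M \<inter> D) \<le> real (n - j) * (h - 1)" .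
    have "(\<Sum>v\<in>M. (if v \<in> S then \<theta> else 1) * (if v \<in> D then c else 1) *
            (if v \<notin> S then 1 else if v \<in> D then b else a))
        \<le> card M + \<theta> * a * card S + \<theta> * c * b * card (M \<inter> D)"
      using finM S DS \<theta> c a1 b1 by (intro sum_step_weight_le) auto
    also have "\<dots> \<le> real (n - j) + real (n - j) * \<delta> + real (n - j) * (h - 1)"
      using m m\<delta> edge by simp
    also have "\<dots> = real (n - j) * (h + \<delta> * 1)"
      by (simp add: algebra_simps)
    \<comment> \<open>Since \<open>h \<ge> 1\<close>, the jump cost can be charged to
      \<open>h\<close>, which turns an additive error into the factor
      \<open>1 + \<delta>\<close>.\<close>
    also have "\<dots> \<le> real (n - j) * (h + \<delta> * h)"
      using h1 \<delta>0 by (intro mult_left_mono add_left_mono) auto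
    finally have le: "(\<Sum>v\<in>M. (if v \<in> S then \<theta> else 1) * (if v \<in> D then c else 1) *
            (if v \<notin> S then 1 else if v \<in> D then b else a)) \<le> real (n - j) * (1 + \<delta>) * h"
      by (simp add: algebra_simps)
    have "(\<Sum>v\<in>M. path_weight \<theta> c S E (Suc j) (\<sigma>(Suc j := v)) *
          path_potential a b S E (Suc j) (\<sigma>(Suc j := v))) =
        path_weight \<theta> c S E j \<sigma> * (\<Sum>v\<in>M. (if v \<in> S then \<theta> else 1) * (if v \<in> D then c else 1) *
            (if v \<notin> S then 1 else if v \<in> D then b else a))"
      unfolding sum_distrib_left path_weight_Suc path_potential_Suc D_def mem_Collect_eq
      by (simp only: mult.assoc)
    also have "\<dots> \<le> path_weight \<theta> c S E j \<sigma> * (real (n - j) * (1 + \<delta>) * h)"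
      using le \<theta> c by (intro mult_left_mono path_weight_nonneg)
    finally show ?thesis
      by (simp add: M_def h_def)
  qed
  have "(\<Sum>\<sigma>\<in>injections (Suc j) n. path_weight \<theta> c S E (Suc j) \<sigma> * path_potential a b S E (Suc j) \<sigma>)
      \<le> (\<Sum>\<sigma>\<in>injections j n.
          path_weight \<theta> c S E j \<sigma> * (real (n - j) * (1 + \<delta>) * path_potential a b S E j \<sigma>))"
    unfolding sum_injections_Suc by (intro sum_mono step)
  also have "\<dots> = real (n - j) * (1 + \<delta>) *
      (\<Sum>\<sigma>\<in>injections j n. path_weight \<theta> c S E j \<sigma> * path_potential a b S E j \<sigma>)"
    by (simp add: sum_distrib_left mult_ac)
  also have "\<dots> \<le> real (n - j) * (1 + \<delta>) * ((1 + \<delta>) ^ j * card (injections j n))"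
    using Suc \<delta>0 by (intro mult_left_mono) auto
  also have "\<dots> = (1 + \<delta>) ^ Suc j * card (injections (Suc j) n)"
    using Suc.prems \<open>K < n\<close> by (simp add: card_injections_Suc)
  finally show ?case .
qed

lemma path_weight_injection:
  assumes "\<tau> \<in> injections K n"
  shows "path_weight \<theta> c S E K \<tau> =
    \<theta> ^ card (S \<inter> \<tau> ` {1..K}) * c ^ card (E \<inter> planted_path K \<tau>)"
proof -
  have "inj_on \<tau> {1..K}"
    using assms by (simp add: injections_def)
  then have "(\<Prod>i\<in>{1..K}. if \<tau> i \<in> S then \<theta> else 1) = (\<Prod>v\<in>\<tau> ` {1..K}. if v \<in> S then \<theta> else 1)"
    by (simp add: prod.reindex)
  also have "\<dots> = \<theta> ^ card (S \<inter> \<tau> ` {1..K})"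
    by (simp add: prod.If_cases Int_commute)
  finally have 1: "(\<Prod>i\<in>{1..K}. if \<tau> i \<in> S then \<theta> else 1) = \<theta> ^ card (S \<inter> \<tau> ` {1..K})" .
  have "(\<Prod>i\<in>{1..<K}. if {\<tau> i, \<tau> (Suc i)} \<in> E then c else 1) =
      (\<Prod>e\<in>planted_path K \<tau>. if e \<in> E then c else 1)"
    unfolding planted_path_image by (subst prod.reindex[OF inj_on_planted_path[OF assms]]) simp
  also have "\<dots> = c ^ card (E \<inter> planted_path K \<tau>)"
    by (subst prod.If_cases) (auto simp: Int_commute planted_path_image)
  finally show ?thesis
    by (simp only: path_weight_def 1)
qed

text \<open>An exponential Markov inequality: every \<tau> in the sum has tilt at least
  \<open>\<theta> powr x\<close>, and the potential is at least 1, so the transfer estimate bounds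
  the tilted sum.\<close>

lemma sum_high_overlap_le:
  fixes \<theta> c r a b \<delta> x :: real
  assumes \<sigma>: "\<sigma> \<in> injections K n" and "K < n"
    and \<theta>: "\<theta> \<ge> 1" and c: "c \<ge> 0" and r: "0 \<le> r" "r < 1" "\<theta> * c \<le> r * (n - K)"
    and b: "b = 1 / (1 - r)" and a: "a = 1 + 2 * r * b" and \<delta>: "\<delta> = \<theta> * a * K / (n - K)"
  shows "(\<Sum>\<tau> | \<tau> \<in> injections K n \<and> real (card (\<sigma> ` {1..K} \<inter> \<tau> ` {1..K})) > x.
            c ^ card (planted_path K \<sigma> \<inter> planted_path K \<tau>))
       \<le> (1 + \<delta>) ^ K / \<theta> powr x * card (injections K n)"
proof -
  let ?S = "\<sigma> ` {1..K}" and ?E = "planted_path K \<sigma>"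
  let ?T = "{\<tau>. \<tau> \<in> injections K n \<and> real (card (?S \<inter> \<tau> ` {1..K})) > x}"
  have h1: "path_potential a b ?S ?E K \<tau> \<ge> 1" for \<tau>
    using r by (auto simp: path_potential_def a b field_simps)
  have w0: "path_weight \<theta> c ?S ?E K \<tau> \<ge> 0" for \<tau>
    using \<theta> c by (intro path_weight_nonneg) auto
  have "\<theta> powr x * (\<Sum>\<tau>\<in>?T. c ^ card (?E \<inter> planted_path K \<tau>)) \<le>
      (\<Sum>\<tau>\<in>?T. path_weight \<theta> c ?S ?E K \<tau>)"
    unfolding sum_distrib_left
  proof (intro sum_mono)
    fix \<tau> assume \<tau>: "\<tau> \<in> ?T"
    have "\<theta> powr x \<le> \<theta> powr real (card (?S \<inter> \<tau> ` {1..K}))"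
      using \<tau> \<theta> by (intro powr_mono) auto
    also have "\<dots> = \<theta> ^ card (?S \<inter> \<tau> ` {1..K})"
      using \<theta> by (intro powr_realpow) auto
    finally show "\<theta> powr x * c ^ card (?E \<inter> planted_path K \<tau>) \<le> path_weight \<theta> c ?S ?E K \<tau>"
      using \<tau> c by (subst path_weight_injection[of _ _ n]) (auto intro!: mult_right_mono)
  qed
  also have "\<dots> \<le> (\<Sum>\<tau>\<in>injections K n. path_weight \<theta> c ?S ?E K \<tau>)"
    using w0 by (intro sum_mono2 finite_injections) auto
  also have "\<dots> \<le> (\<Sum>\<tau>\<in>injections K n. path_weight \<theta> c ?S ?E K \<tau> * path_potential a b ?S ?E K \<tau>)"
    using mult_left_mono[OF h1 w0] by (intro sum_mono) simp
  also have "\<dots> \<le> (1 + \<delta>) ^ K * card (injections K n)"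
    using \<theta> by (intro sum_path_weight_potential_le[OF _ _ \<open>K < n\<close> planted_path_neighbours[OF \<sigma>] _ c r b a \<delta>])
      (simp_all add: card_injections_image[OF \<sigma>] del: One_nat_def)
  finally show ?thesis
    using \<theta> by (simp add: field_simps)
qed

section \<open>From pairs of paths to the overlap of an estimator\<close>

lemma injections_nonempty: "K \<le> n \<Longrightarrow> injections K n \<noteq> {}"
proof -
  assume "K \<le> n"
  then have "card (injections K n) > 0"
  proof (induction K)
    case 0
    then show ?case by (simp add: injections_def)
  next
    case (Suc K)
    then show ?case by (simp add: card_injections_Suc)
  qed
  then show ?thesis by auto
qed

text \<open>A second moment argument, to be used with \<open>J\<close> the paths present in a graph
  and \<open>A\<close> the estimate. With \<open>k i\<close> the number of sets
  \<open>V \<sigma>\<close> containing \<open>i\<close>, the left side is the sum of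
  \<open>k\<close> over \<open>A\<close>, and the sum of squares of \<open>k\<close> counts
  intersections over pairs from \<open>J\<close>.\<close>

lemma sum_card_Int_le:
  fixes V :: "'i \<Rightarrow> 'a set" and e t :: real
  assumes A: "finite A" "card A = K" and J: "finite J" and e: "e > 0" and t: "t > 0"
  defines "B \<equiv> \<Sum>\<sigma>\<in>J. \<Sum>\<tau>\<in>J. of_bool (real (card (V \<sigma> \<inter> V \<tau>)) > e\<^sup>2 * K)"
  assumes V: "\<And>\<sigma>. \<sigma> \<in> J \<Longrightarrow> finite (V \<sigma>)"
  shows "(\<Sum>\<sigma>\<in>J. real (card (A \<inter> V \<sigma>))) \<le> K * (e * card J + B / (2 * t) + t / 2)"
proof -
  define k where "k = (\<lambda>i. \<Sum>\<sigma>\<in>J. of_bool (i \<in> V \<sigma>) :: real)"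
  \<comment> \<open>AM-GM with the parameter \<open>s\<close> keeps the bound linear in \<open>card J\<close> and \<open>B\<close>, so that one can take expectations.\<close>
  define s where "s = e * card J + t"
  have s: "s > 0" "s \<ge> e * card J" "s \<ge> t"
    using e t by (auto simp: s_def intro: add_nonneg_pos)
  have card_eq: "real (card (A \<inter> W)) = (\<Sum>i\<in>A. of_bool (i \<in> W))" for W
    using A by (simp add: of_bool_def sum.If_cases)
  have B0: "B \<ge> 0"
    unfolding B_def by (intro sum_nonneg) auto
  have "(\<Sum>i\<in>A. (k i)\<^sup>2) = (\<Sum>i\<in>A. \<Sum>\<sigma>\<in>J. \<Sum>\<tau>\<in>J. of_bool (i \<in> V \<sigma> \<inter> V \<tau>))"
    by (simp add: k_def power2_eq_square sum_product of_bool_conj)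
  also have "\<dots> = (\<Sum>\<sigma>\<in>J. \<Sum>\<tau>\<in>J. real (card (A \<inter> (V \<sigma> \<inter> V \<tau>))))"
    unfolding card_eq by (subst sum.swap) (intro sum.cong refl sum.swap)
  \<comment> \<open>A pair with small overlap contributes at most \<open>e\<^sup>2 * K\<close>; any
    other pair gets the trivial bound \<open>K = card A\<close>.\<close>
  also have "\<dots> \<le> (\<Sum>\<sigma>\<in>J. \<Sum>\<tau>\<in>J. e\<^sup>2 * K + K * of_bool (real (card (V \<sigma> \<inter> V \<tau>)) > e\<^sup>2 * K))"
  proof (intro sum_mono)
    fix \<sigma> \<tau> assume "\<sigma> \<in> J" "\<tau> \<in> J"
    have "card (A \<inter> (V \<sigma> \<inter> V \<tau>)) \<le> card (V \<sigma> \<inter> V \<tau>)" "card (A \<inter> (V \<sigma> \<inter> V \<tau>)) \<le> K"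
      using A V[OF \<open>\<sigma> \<in> J\<close>] by (auto intro!: card_mono simp: A(2)[symmetric])
    then show "real (card (A \<inter> (V \<sigma> \<inter> V \<tau>))) \<le>
        e\<^sup>2 * K + K * of_bool (real (card (V \<sigma> \<inter> V \<tau>)) > e\<^sup>2 * K)"
      by (auto intro: order_trans add_increasing)
  qed
  also have "\<dots> = K * (e * card J)\<^sup>2 + K * B"
    by (simp add: B_def sum.distrib sum_distrib_left power2_eq_square)
  finally have sq: "(\<Sum>i\<in>A. (k i)\<^sup>2) \<le> K * (e * card J)\<^sup>2 + K * B" .
  have "(\<Sum>\<sigma>\<in>J. real (card (A \<inter> V \<sigma>))) = (\<Sum>i\<in>A. k i)"
    unfolding card_eq k_def by (rule sum.swap)
  also have "\<dots> \<le> (\<Sum>i\<in>A. (k i)\<^sup>2 / (2 * s) + s / 2)"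
  proof (intro sum_mono)
    fix i
    have "0 \<le> (k i - s)\<^sup>2 / (2 * s)"
      using s by simp
    also have "\<dots> = (k i)\<^sup>2 / (2 * s) + s / 2 - k i"
      using s by (simp add: power2_eq_square field_simps)
    finally show "k i \<le> (k i)\<^sup>2 / (2 * s) + s / 2" by simp
  qed
  also have "\<dots> = (\<Sum>i\<in>A. (k i)\<^sup>2) / (2 * s) + K * s / 2"
    using A by (simp add: sum.distrib sum_divide_distrib)
  also have "\<dots> \<le> (K * (e * card J)\<^sup>2 + K * B) / (2 * s) + K * s / 2"
    using sq s by (intro add_right_mono divide_right_mono) auto
  also have "\<dots> = K * ((e * card J) * (e * card J) / (2 * s) + B / (2 * s) + s / 2)"
    by (simp add: power2_eq_square add_divide_distrib algebra_simps)
  \<comment> \<open>Both lower bounds on \<open>s\<close> are used: \<open>e * card J\<close> in the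
    first quotient and \<open>t\<close> in the second.\<close>
  also have "\<dots> \<le> K * ((e * card J) / 2 + B / (2 * t) + s / 2)"
  proof (intro mult_left_mono add_mono order_refl)
    have "(e * card J) * (e * card J) \<le> (e * card J) * s"
      using s e by (intro mult_left_mono) auto
    then show "(e * card J) * (e * card J) / (2 * s) \<le> (e * card J) / 2"
      using s by (simp add: field_simps)
    show "B / (2 * s) \<le> B / (2 * t)"
      using s t B0 by (intro divide_left_mono) auto
  qed auto
  also have "\<dots> = K * (e * card J + B / (2 * t) + t / 2)"
    by (simp add: s_def field_simps)
  finally show ?thesis .
qed

lemma integrable_erdos_renyi: "integrable (measure_pmf (erdos_renyi n p)) (f :: _ \<Rightarrow> real)"
  by (intro integrable_measure_pmf_finite
      finite_subset[OF set_pmf_erdos_renyi_subset]) (simp add: finite_node_pairs)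

text \<open>The graph and the injection are independent, so the injection may be drawn first.
  Summing the membership indicators over all nodes then gives the size of the intersection.\<close>

lemma overlap_eq_expectation:
  assumes "K \<le> n"
  shows "overlap n lam K est =
    (\<Sum>\<sigma>\<in>injections K n. measure_pmf.expectation (erdos_renyi n (lam / n))
       (\<lambda>G. real (card (est (G \<union> planted_path K \<sigma>) \<inter> \<sigma> ` {1..K})))) / card (injections K n)"
proof -
  let ?ER = "erdos_renyi n (lam / n)" and ?I = "injections K n"
  have I: "?I \<noteq> {}" "finite ?I"
    using assms injections_nonempty finite_injections by auto
  have P1: "P1 n lam K = pmf_of_set ?I \<bind>
      (\<lambda>\<sigma>. map_pmf (\<lambda>G. (G \<union> planted_path K \<sigma>, \<sigma> ` {1..K})) ?ER)"
    unfolding P1_def map_pmf_def by (subst bind_commute_pmf) simp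
  have fin: "finite (set_pmf ?ER)"
    by (rule finite_subset[OF set_pmf_erdos_renyi_subset]) (simp add: finite_node_pairs)
  have "overlap n lam K est = (\<Sum>i\<in>{1..n}. (\<Sum>\<sigma>\<in>?I. measure_pmf.expectation ?ER
       (\<lambda>G. of_bool (i \<in> est (G \<union> planted_path K \<sigma>) \<and> i \<in> \<sigma> ` {1..K}))) / card ?I)"
    unfolding overlap_def
  proof (intro sum.cong refl)
    fix i
    let ?A = "{(G, S). i \<in> est G \<and> i \<in> S}"
    have "measure_pmf.prob (P1 n lam K) ?A = measure_pmf.expectation (P1 n lam K) (indicator ?A)"
      by simp
    also have "\<dots> = (\<Sum>\<sigma>\<in>?I. measure_pmf.expectation ?ER
        (\<lambda>G. indicator ?A (G \<union> planted_path K \<sigma>, \<sigma> ` {1..K}))) / card ?I"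
      unfolding P1 using I fin
      by (subst pmf_expectation_bind_pmf_of_set)
        (simp_all only: integral_map_pmf set_map_pmf finite_imageI real_scaleR_def
          sum_distrib_left[symmetric] divide_inverse_commute simp_thms)
    finally show "measure_pmf.prob (P1 n lam K) ?A = (\<Sum>\<sigma>\<in>?I. measure_pmf.expectation ?ER
       (\<lambda>G. of_bool (i \<in> est (G \<union> planted_path K \<sigma>) \<and> i \<in> \<sigma> ` {1..K}))) / card ?I"
      by (simp add: indicator_def)
  qed
  also have "\<dots> = (\<Sum>\<sigma>\<in>?I. \<Sum>i\<in>{1..n}. measure_pmf.expectation ?ER
       (\<lambda>G. of_bool (i \<in> est (G \<union> planted_path K \<sigma>) \<and> i \<in> \<sigma> ` {1..K}))) / card ?I"
    by (subst sum.swap) (simp add: sum_divide_distrib)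
  also have "(\<Sum>\<sigma>\<in>?I. \<Sum>i\<in>{1..n}. measure_pmf.expectation ?ER
       (\<lambda>G. of_bool (i \<in> est (G \<union> planted_path K \<sigma>) \<and> i \<in> \<sigma> ` {1..K}))) =
      (\<Sum>\<sigma>\<in>?I. measure_pmf.expectation ?ER
       (\<lambda>G. real (card (est (G \<union> planted_path K \<sigma>) \<inter> \<sigma> ` {1..K}))))"
  proof (intro sum.cong refl)
    fix \<sigma> assume "\<sigma> \<in> ?I"
    then have sub: "\<sigma> ` {1..K} \<subseteq> {1..n}"
      by (auto simp: injections_def)
    have "real (card (X \<inter> \<sigma> ` {1..K})) = (\<Sum>i\<in>{1..n}. of_bool (i \<in> X \<and> i \<in> \<sigma> ` {1..K}))" for X
    proof -
      have "{1..n} \<inter> {i. i \<in> X \<and> i \<in> \<sigma> ` {1..K}} = X \<inter> \<sigma> ` {1..K}"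
        using sub by blast
      then show ?thesis
        by (simp only: of_bool_def sum.If_cases finite_atLeastAtMost) simp
    qed
    then show "(\<Sum>i\<in>{1..n}. measure_pmf.expectation ?ER
         (\<lambda>G. of_bool (i \<in> est (G \<union> planted_path K \<sigma>) \<and> i \<in> \<sigma> ` {1..K}))) =
        measure_pmf.expectation ?ER (\<lambda>G. real (card (est (G \<union> planted_path K \<sigma>) \<inter> \<sigma> ` {1..K})))"
      by (simp only:) (intro Bochner_Integration.integral_sum[symmetric] integrable_erdos_renyi)
  qed
  finally show ?thesis .
qed

text \<open>In the pure Erdos-Renyi graph, \<open>Z\<close> counts the paths present,
  \<open>B\<close> the pairs of them with large overlap, and \<open>X\<close> adds up the overlaps
  of the estimate with all of them. The change of measure identifies \<open>E0 X\<close> with \<mu>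
  times the overlap, where \<mu> is the mean of \<open>Z\<close>.\<close>

lemma overlap_le:
  fixes lam e Q :: real
  assumes p: "p = lam / n" "0 < p" "p \<le> 1" and K: "K \<le> n" and e: "e > 0"
    and est: "\<And>G. est G \<subseteq> {1..n}" "\<And>G. card (est G) = K"
    and Q: "\<And>\<sigma>. \<sigma> \<in> injections K n \<Longrightarrow>
      (\<Sum>\<tau> | \<tau> \<in> injections K n \<and> real (card (\<sigma> ` {1..K} \<inter> \<tau> ` {1..K})) > e\<^sup>2 * K.
            (1 / p) ^ card (planted_path K \<sigma> \<inter> planted_path K \<tau>)) \<le> Q * card (injections K n)"
  shows "overlap n lam K est \<le> K * (3 / 2 * e + Q / (2 * e))"
proof -
  let ?I = "injections K n" and ?P = "planted_path K" and ?V = "\<lambda>\<sigma>. \<sigma> ` {1..K}"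
  define E0 where "E0 = (\<lambda>f :: nat set set \<Rightarrow> real. measure_pmf.expectation (erdos_renyi n p) f)"
  define T where "T = (\<lambda>\<sigma>. {\<tau>. \<tau> \<in> ?I \<and> real (card (?V \<sigma> \<inter> ?V \<tau>)) > e\<^sup>2 * K})"
  define N where "N = real (card ?I)"
  define \<mu> where "\<mu> = N * p ^ (K - 1)"
  define X where "X = (\<lambda>G. \<Sum>\<sigma>\<in>?I. of_bool (?P \<sigma> \<subseteq> G) * real (card (est G \<inter> ?V \<sigma>)))"
  define Z where "Z = (\<lambda>G. \<Sum>\<sigma>\<in>?I. of_bool (?P \<sigma> \<subseteq> G) :: real)"
  define B where "B = (\<lambda>G. \<Sum>\<sigma>\<in>?I. \<Sum>\<tau>\<in>T \<sigma>. of_bool (?P \<sigma> \<union> ?P \<tau> \<subseteq> G) :: real)"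
  have finI: "finite ?I" and N: "N > 0"
    using finite_injections injections_nonempty[OF K] by (auto simp: N_def card_gt_0_iff)
  have \<mu>: "\<mu> > 0"
    using N p by (simp add: \<mu>_def)
  have finP: "finite (?P \<sigma>)" for \<sigma>
    by (simp add: planted_path_image)
  have E0_sum: "E0 (\<lambda>G. \<Sum>x\<in>A. f x G) = (\<Sum>x\<in>A. E0 (f x))" for A :: "(nat \<Rightarrow> nat) set" and f
    unfolding E0_def by (intro Bochner_Integration.integral_sum integrable_erdos_renyi)
  have E0_union: "E0 (\<lambda>G. of_bool (P \<subseteq> G) * g G) = p ^ card P * E0 (\<lambda>G. g (G \<union> P))"
    if "finite P" "P \<subseteq> node_pairs n" for P g
    unfolding E0_def using expectation_erdos_renyi_union[OF that, of p g] p by simp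
  have E0_sub: "E0 (\<lambda>G. of_bool (P \<subseteq> G)) = p ^ card P" if "finite P" "P \<subseteq> node_pairs n" for P
    using E0_union[OF that, of "\<lambda>_. 1"] by (simp add: E0_def)
  have "E0 X = (\<Sum>\<sigma>\<in>?I. p ^ (K - 1) * E0 (\<lambda>G. real (card (est (G \<union> ?P \<sigma>) \<inter> ?V \<sigma>))))"
    unfolding X_def E0_sum
    by (intro sum.cong refl, subst E0_union) (auto simp: finP planted_path_subset card_planted_path)
  also have "\<dots> = \<mu> * overlap n lam K est"
    using N unfolding overlap_eq_expectation[OF K] E0_def p(1)[symmetric]
    by (simp add: \<mu>_def N_def sum_distrib_left[symmetric])
  finally have EX: "\<mu> * overlap n lam K est = E0 X" ..
  have EZ: "E0 Z = \<mu>"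
    unfolding Z_def E0_sum
    by (simp add: E0_sub finP planted_path_subset card_planted_path \<mu>_def N_def cong: sum.cong)
  have "E0 B = (\<Sum>\<sigma>\<in>?I. \<Sum>\<tau>\<in>T \<sigma>. p ^ card (?P \<sigma> \<union> ?P \<tau>))"
    unfolding B_def E0_sum
  proof (intro sum.cong refl)
    fix \<sigma> \<tau> assume "\<sigma> \<in> ?I" "\<tau> \<in> T \<sigma>"
    then show "E0 (\<lambda>G. of_bool (?P \<sigma> \<union> ?P \<tau> \<subseteq> G)) = p ^ card (?P \<sigma> \<union> ?P \<tau>)"
      using planted_path_subset[of \<sigma> K n] planted_path_subset[of \<tau> K n]
      by (intro E0_sub) (auto simp: finP T_def)
  qed
  \<comment> \<open>Shared edges are paid for once only: the union has \<open>2 * (K - 1)\<close>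
    edges less the common ones, each of which yields a factor \<open>1 / p\<close>.\<close>
  also have "\<dots> = (\<Sum>\<sigma>\<in>?I. p ^ (2 * (K - 1)) * (\<Sum>\<tau>\<in>T \<sigma>. (1 / p) ^ card (?P \<sigma> \<inter> ?P \<tau>)))"
    unfolding sum_distrib_left
  proof (intro sum.cong refl)
    fix \<sigma> \<tau> assume \<sigma>: "\<sigma> \<in> ?I" and \<tau>: "\<tau> \<in> T \<sigma>"
    have "card (?P \<sigma> \<union> ?P \<tau>) + card (?P \<sigma> \<inter> ?P \<tau>) = 2 * (K - 1)"
      using \<sigma> \<tau> card_Un_Int[OF finP finP, of \<sigma> \<tau>] card_planted_path[of \<sigma> K n]
        card_planted_path[of \<tau> K n] by (simp add: T_def)
    then have "p ^ (2 * (K - 1)) = p ^ card (?P \<sigma> \<union> ?P \<tau>) * p ^ card (?P \<sigma> \<inter> ?P \<tau>)"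
      by (metis power_add)
    then show "p ^ card (?P \<sigma> \<union> ?P \<tau>) = p ^ (2 * (K - 1)) * (1 / p) ^ card (?P \<sigma> \<inter> ?P \<tau>)"
      using p(2) by (simp add: power_one_over)
  qed
  also have "\<dots> \<le> (\<Sum>\<sigma>\<in>?I. p ^ (2 * (K - 1)) * (Q * N))"
    using Q p by (intro sum_mono mult_left_mono) (auto simp: T_def N_def)
  also have "\<dots> = Q * \<mu>\<^sup>2"
    by (simp add: \<mu>_def N_def power2_eq_square mult_2 power_add)
  finally have EB: "E0 B \<le> Q * \<mu>\<^sup>2" .
  \<comment> \<open>Here \<open>t = e * \<mu>\<close>, the scale of \<open>e * Z\<close>. The bound
    is linear in \<open>Z\<close> and \<open>B\<close>, so their means suffice and no concentration
    of \<open>Z\<close> enters.\<close>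
  have pointwise: "X G \<le> K * (e * Z G + B G / (2 * (e * \<mu>)) + e * \<mu> / 2)" for G
  proof -
    define J where "J = {\<sigma>\<in>?I. ?P \<sigma> \<subseteq> G}"
    have J: "finite J" "J \<subseteq> ?I"
      using finI by (auto simp: J_def)
    have XJ: "X G = (\<Sum>\<sigma>\<in>J. real (card (est G \<inter> ?V \<sigma>)))"
      unfolding X_def J_def using finI by (intro sum.mono_neutral_cong_right) auto
    have ZJ: "Z G = card J"
      unfolding Z_def J_def using finI by (simp add: of_bool_def sum.If_cases Int_def)
    have "B G = (\<Sum>\<sigma>\<in>J. \<Sum>\<tau>\<in>J. of_bool (real (card (?V \<sigma> \<inter> ?V \<tau>)) > e\<^sup>2 * K))"
      unfolding B_def
    proof (rule sum.mono_neutral_cong_right[OF finI J(2)], rule ballI)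
      fix \<sigma> assume "\<sigma> \<in> ?I - J"
      then show "(\<Sum>\<tau>\<in>T \<sigma>. of_bool (?P \<sigma> \<union> ?P \<tau> \<subseteq> G) :: real) = 0"
        by (auto simp: J_def)
    next
      fix \<sigma> assume "\<sigma> \<in> J"
      then have "(\<Sum>\<tau>\<in>T \<sigma>. of_bool (?P \<sigma> \<union> ?P \<tau> \<subseteq> G) :: real) = (\<Sum>\<tau>\<in>T \<sigma> \<inter> J. 1)"
        using finI by (intro sum.mono_neutral_cong_right) (auto simp: J_def T_def)
      also have "\<dots> = (\<Sum>\<tau>\<in>J. of_bool (real (card (?V \<sigma> \<inter> ?V \<tau>)) > e\<^sup>2 * K))"
        using J by (intro sum.mono_neutral_cong_left) (auto simp: T_def)
      finally show "(\<Sum>\<tau>\<in>T \<sigma>. of_bool (?P \<sigma> \<union> ?P \<tau> \<subseteq> G) :: real) =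
          (\<Sum>\<tau>\<in>J. of_bool (real (card (?V \<sigma> \<inter> ?V \<tau>)) > e\<^sup>2 * K))" .
    qed
    then show ?thesis
      unfolding XJ ZJ using J e \<mu> est finite_subset[OF est(1)]
      by (simp only:) (intro sum_card_Int_le; simp)
  qed
  have "\<mu> * overlap n lam K est \<le> E0 (\<lambda>G. K * (e * Z G + B G / (2 * (e * \<mu>)) + e * \<mu> / 2))"
    unfolding EX unfolding E0_def by (intro integral_mono integrable_erdos_renyi pointwise)
  also have "\<dots> = K * (e * E0 Z + E0 B / (2 * (e * \<mu>)) + e * \<mu> / 2)"
    unfolding E0_def by (simp add: integrable_erdos_renyi)
  also have "\<dots> \<le> K * (e * \<mu> + Q * \<mu>\<^sup>2 / (2 * (e * \<mu>)) + e * \<mu> / 2)"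
    using EZ EB e \<mu> by (intro mult_left_mono add_mono divide_right_mono) auto
  also have "\<dots> = \<mu> * (K * (3 / 2 * e + Q / (2 * e)))"
    using e \<mu> by (simp add: field_simps power2_eq_square)
  finally show ?thesis
    using \<mu> by simp
qed

section \<open>Asymptotics\<close>

theorem theorem7:
  fixes lam :: real and K :: "nat \<Rightarrow> nat"
    and est :: "nat \<Rightarrow> nat set set \<Rightarrow> nat set"
  assumes "lam > 1"
    and "(\<lambda>n. real (K n)) \<in> \<omega>(\<lambda>n. sqrt (real n))"
    and "(\<lambda>n. real (K n)) \<in> o(\<lambda>n. real n)"
    and "eventually (\<lambda>n. \<forall>G. est n G \<subseteq> {1..n} \<and> card (est n G) = K n) at_top"
  shows "(\<lambda>n. overlap n lam (K n) (est n)) \<in> o(\<lambda>n. real (K n))"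
proof (rule landau_o.smallI)
  fix c :: real assume c: "c > 0"
  \<comment> \<open>The final bound is \<open>3 / 2 * e + e\<^sup>2 / (2 * e) = 2 * e\<close>, which
    this choice makes equal to \<open>c\<close>.\<close>
  define e where "e = c / 2"
  \<comment> \<open>The gain \<open>lam\<close> is split into three equal factors: one for the tilt
    \<theta>, one for the ratio \<open>r = 1 / \<theta>\<close>, and one as slack against the loss
    \<open>1 - K n / n\<close>.\<close>
  define \<theta> where "\<theta> = lam powr (1 / 3)"
  define r where "r = 1 / \<theta>"
  define b where "b = 1 / (1 - r)"
  define a where "a = 1 + 2 * r * b"
  define f where "f = (\<lambda>n. real (K n) / real n)"
  have e: "e > 0"
    using c by (simp add: e_def)
  have \<theta>: "\<theta> > 1"
    using assms(1) by (simp add: \<theta>_def)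
  have \<theta>3: "\<theta> * \<theta> * \<theta> = lam"
    using assms(1) by (simp add: \<theta>_def powr_add[symmetric])
  have r: "0 < r" "r < 1"
    using \<theta> by (auto simp: r_def)
  have f: "f \<longlonglongrightarrow> 0"
    unfolding f_def using assms(3) by (rule smalloD_tendsto)
  have K_top: "filterlim (\<lambda>n. real (K n)) at_top sequentially"
  proof (rule filterlim_at_top_mono)
    show "filterlim (\<lambda>n. sqrt (real n)) at_top sequentially"
      by (rule filterlim_compose[OF sqrt_at_top filterlim_real_sequentially])
    show "\<forall>\<^sub>F n in sequentially. sqrt (real n) \<le> real (K n)"
      using landau_omega.smallD[OF assms(2), of 1] by simp
  qed
  have \<delta>_lim: "(\<lambda>n. 1 + \<theta> * a * (f n / (1 - f n))) \<longlonglongrightarrow> 1 + \<theta> * a * (0 / (1 - 0))"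
    by (intro tendsto_intros f) auto
  \<comment> \<open>The left side is \<open>1 + \<delta>\<close> written through
    \<open>f n = K n / n\<close>. As \<delta> tends to 0, its growth per vertex eventually uses less
    than half of the exponent \<open>e\<^sup>2\<close> gained from the tilt.\<close>
  have "\<forall>\<^sub>F n in sequentially. 1 + \<theta> * a * (f n / (1 - f n)) < \<theta> powr (e\<^sup>2 / 2)"
    using \<delta>_lim \<theta> e by (intro order_tendstoD) (auto intro: gr_one_powr)
  moreover have "\<forall>\<^sub>F n in sequentially. f n < 1 - r"
    using f r by (intro order_tendstoD) auto
  moreover have "\<forall>\<^sub>F n in sequentially. \<theta> powr (- (e\<^sup>2 / 2) * real (K n)) < e\<^sup>2"
  proof (rule order_tendstoD)
    have "filterlim (\<lambda>n. ln \<theta> * (e\<^sup>2 / 2) * real (K n)) at_top sequentially"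
      using \<theta> e by (intro filterlim_tendsto_pos_mult_at_top[OF tendsto_const _ K_top]) auto
    then have "filterlim (\<lambda>n. - (ln \<theta> * (e\<^sup>2 / 2) * real (K n))) at_bot sequentially"
      by (simp add: filterlim_uminus_at_top)
    then have "(\<lambda>n. exp (- (ln \<theta> * (e\<^sup>2 / 2) * real (K n)))) \<longlonglongrightarrow> 0"
      by (rule filterlim_compose[OF exp_at_bot])
    then show "(\<lambda>n. \<theta> powr (- (e\<^sup>2 / 2) * real (K n))) \<longlonglongrightarrow> 0"
      using \<theta> by (simp add: powr_def mult_ac)
  qed (use e in auto)
  moreover have "\<forall>\<^sub>F n in sequentially. lam \<le> real n"
    using filterlim_real_sequentially by (simp add: filterlim_at_top)
  ultimately show "\<forall>\<^sub>F n in sequentially. norm (overlap n lam (K n) (est n)) \<le> c * norm (real (K n))"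
    using assms(4)
  proof eventually_elim
    case (elim n)
    define \<delta> where "\<delta> = \<theta> * a * K n / (real n - real (K n))"
    have n: "real n > 0"
      using elim assms(1) by linarith
    have "f n < 1"
      using elim r by linarith
    then have Kn: "K n < n"
      using n by (simp add: f_def)
    have \<delta>: "\<delta> = \<theta> * a * (f n / (1 - f n))"
      using n Kn by (simp add: \<delta>_def f_def field_simps)
    have \<delta>0: "\<delta> \<ge> 0"
      using \<theta> r Kn by (auto simp: \<delta>_def a_def b_def)
    \<comment> \<open>As \<open>\<theta> / lam = r * r\<close>, the condition reduces to
      \<open>r \<le> 1 - f n\<close>, which holds for large \<open>n\<close>.\<close>
    have rK: "\<theta> * (real n / lam) \<le> r * (real n - real (K n))"
    proof -
      have "\<theta> * (real n / lam) = r * (r * n)"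
        using \<theta> unfolding \<theta>3[symmetric] r_def by (simp add: field_simps)
      also have "\<dots> \<le> r * ((1 - f n) * n)"
        using elim r n by (intro mult_left_mono mult_right_mono) auto
      also have "\<dots> = r * (real n - real (K n))"
        using n by (simp add: f_def field_simps)
      finally show ?thesis .
    qed
    \<comment> \<open>The remaining half of the exponent makes the quotient exponentially small in
      \<open>K n\<close>, and \<open>K n\<close> tends to infinity.\<close>
    have Q: "(1 + \<delta>) ^ K n / \<theta> powr (e\<^sup>2 * K n) \<le> e\<^sup>2"
    proof -
      have "(1 + \<delta>) ^ K n \<le> (\<theta> powr (e\<^sup>2 / 2)) ^ K n"
        using elim \<delta> \<delta>0 by (intro power_mono) auto
      also have "\<dots> = \<theta> powr (e\<^sup>2 / 2 * K n)"
        using \<theta> by (simp add: powr_realpow[symmetric] powr_powr)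
      finally have "(1 + \<delta>) ^ K n / \<theta> powr (e\<^sup>2 * K n) \<le> \<theta> powr (e\<^sup>2 / 2 * K n) / \<theta> powr (e\<^sup>2 * K n)"
        by (rule divide_right_mono) simp
      also have "\<dots> = \<theta> powr (- (e\<^sup>2 / 2) * K n)"
        by (simp add: powr_diff[symmetric] field_simps)
      finally show ?thesis
        using elim by simp
    qed
    have "overlap n lam (K n) (est n) \<le> K n * (3 / 2 * e + e\<^sup>2 / (2 * e))"
    proof (rule overlap_le[OF refl])
      fix \<sigma> assume \<sigma>: "\<sigma> \<in> injections (K n) n"
      have "(\<Sum>\<tau> | \<tau> \<in> injections (K n) n \<and>
              real (card (\<sigma> ` {1..K n} \<inter> \<tau> ` {1..K n})) > e\<^sup>2 * K n.
            (real n / lam) ^ card (planted_path (K n) \<sigma> \<inter> planted_path (K n) \<tau>))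
          \<le> (1 + \<delta>) ^ K n / \<theta> powr (e\<^sup>2 * K n) * card (injections (K n) n)"
        using \<theta> r assms(1) rK \<delta>_def Kn
        by (intro sum_high_overlap_le[OF \<sigma> Kn, where r = r and b = b and a = a])
          (auto simp: a_def b_def of_nat_diff)
      also have "\<dots> \<le> e\<^sup>2 * card (injections (K n) n)"
        using Q by (rule mult_right_mono) simp
      finally show "(\<Sum>\<tau> | \<tau> \<in> injections (K n) n \<and>
              real (card (\<sigma> ` {1..K n} \<inter> \<tau> ` {1..K n})) > e\<^sup>2 * K n.
            (1 / (lam / n)) ^ card (planted_path (K n) \<sigma> \<inter> planted_path (K n) \<tau>))
          \<le> e\<^sup>2 * card (injections (K n) n)"
        by simp
    qed (use elim assms(1) n Kn e in auto)
    also have "\<dots> = c * K n"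
      using e by (simp add: e_def power2_eq_square field_simps)
    finally have "overlap n lam (K n) (est n) \<le> c * K n" .
    moreover have "overlap n lam (K n) (est n) \<ge> 0"
      unfolding overlap_def by (intro sum_nonneg) auto
    ultimately show ?case
      by simp
  qed
qed

end
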